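(* For every integer $k\ge 2$, the broadcast time of the graph $MB_k$ on $n=2^k$ vertices is $b(MB_k)=\left\lfloor \frac{3\log_2 n}{2}\right\rfloor$.
   Context: Broadcasting in a connected graph $G$: initially only an originator vertex $v$ holds a message; in each discrete time unit, every vertex holding the message may send it to at most one uninformed neighbor. $b(v,G)$ is the minimum number of time units needed to inform all vertices, and $b(G)=\max_{v} b(v,G)$. The graphs $MB_k$ are defined recursively: $MB_2$ is the path $s-a-b-t$ on four vertices. For $k\ge 3$, take two disjoint copies $C_1,C_2$ of $MB_{k-1}$ with distinguished vertices $s_1,t_1$ in $C_1$ and $s_2,t_2$ in $C_2$, add the edges $\{s_1,s_2\}$ and $\{t_1,t_2\}$, and set $s=s_2$, $t=t_1$. $MB_k$ has $2^k$ vertices. *)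

theory Defs
  imports Complex_Main "Graph_Theory.Graph_Theory"
begin

section \<open>Broadcasting\<close>

text \<open>
  One time unit, taking the set \<open>A\<close> of informed vertices to \<open>B\<close>: \<open>C\<close> is the set of calls
  (sender, receiver). Each call goes from an informed vertex to an uninformed neighbour, and
  \<open>single_valued C\<close> says that no vertex makes more than one call. Vertices may stay idle. Two
  vertices may call the same receiver, which merely wastes a call.
\<close>

definition broadcast_round :: "'a pair_pre_digraph \<Rightarrow> 'a set \<Rightarrow> 'a set \<Rightarrow> bool" where
  "broadcast_round G A B \<longleftrightarrow>
     (\<exists>C. C \<subseteq> {(u, w) \<in> parcs G. u \<in> A \<and> w \<notin> A} \<and> single_valued C \<and> B = A \<union> Range C)"

definition broadcast_time_from :: "'a \<Rightarrow> 'a pair_pre_digraph \<Rightarrow> nat" where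
  "broadcast_time_from v G = (LEAST \<tau>. (broadcast_round G ^^ \<tau>) {v} (pverts G))"

definition broadcast_time :: "'a pair_pre_digraph \<Rightarrow> nat" where
  "broadcast_time G = Max ((\<lambda>v. broadcast_time_from v G) ` pverts G)"

text \<open>In a finite connected graph every originator can inform all vertices, so the
  \<open>LEAST\<close> above is taken over a nonempty set.\<close>

lemma broadcast_possible:
  fixes G :: "'a pair_pre_digraph"
  assumes "pair_graph G" "connected G" "v \<in> pverts G"
  shows "\<exists>\<tau>. (broadcast_round G ^^ \<tau>) {v} (pverts G)"
proof -
  interpret pair_graph G by fact
  have "strongly_connected G"
    using pair_sym_arcs assms(2) by (rule symmetric_connected_imp_strongly_connected)
  then have reach: "v \<rightarrow>\<^sup>*\<^bsub>with_proj G\<^esub> w" if "w \<in> pverts G" for w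
    using assms(3) that by (auto simp: strongly_connected_def)
  have "\<exists>\<tau>. (broadcast_round G ^^ \<tau>) A (pverts G)" if "v \<in> A" "A \<subseteq> pverts G" for A
    using that
  proof (induction "card (pverts G - A)" arbitrary: A rule: less_induct)
    case less
    show ?case
    proof (cases "A = pverts G")
      case True
      then have "(broadcast_round G ^^ 0) A (pverts G)" by simp
      then show ?thesis by blast
    next
      case False
      have "\<exists>(u, w) \<in> parcs G. u \<in> A \<and> w \<notin> A"
      proof (rule ccontr)
        assume closed: "\<not> ?thesis"
        have "w \<in> A" if "v \<rightarrow>\<^sup>*\<^bsub>with_proj G\<^esub> w" for w
          using that by (induction rule: reachable_induct) (use less.prems closed in auto)
        with reach less.prems False show False by blast
      qed
      then obtain u w where uw: "(u, w) \<in> parcs G" "u \<in> A" "w \<notin> A" by blast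
      then have w: "w \<in> pverts G" by (blast dest: in_arcsD2)
      have step: "broadcast_round G A (insert w A)"
        unfolding broadcast_round_def
        by (rule exI[of _ "{(u, w)}"]) (use uw in \<open>auto simp: single_valued_def\<close>)
      have "card (pverts G - insert w A) < card (pverts G - A)"
        using w uw pair_finite_verts by (intro psubset_card_mono) auto
      then obtain \<tau> where "(broadcast_round G ^^ \<tau>) (insert w A) (pverts G)"
        using less.hyps less.prems w by (metis insert_subset insert_iff)
      with step have "(broadcast_round G ^^ Suc \<tau>) A (pverts G)"
        by (rule relpowp_Suc_I2)
      then show ?thesis by blast
    qed
  qed
  with assms(3) show ?thesis by simp
qed


section \<open>The graphs \<open>MB\<^sub>k\<close>\<close>

text \<open>The constructors \<open>Copy1\<close> and \<open>Copy2\<close> make the two copies of the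
  previous graph disjoint.\<close>

datatype mb_vertex = Vs | Va | Vb | Vt | Copy1 mb_vertex | Copy2 mb_vertex

text \<open>The catch-all equations serve \<open>k = 2\<close>; the values for \<open>k < 2\<close> are irrelevant.\<close>

fun mb_s :: "nat \<Rightarrow> mb_vertex" where
  "mb_s (Suc (Suc (Suc k))) = Copy2 (mb_s (Suc (Suc k)))"
| "mb_s _ = Vs"

fun mb_t :: "nat \<Rightarrow> mb_vertex" where
  "mb_t (Suc (Suc (Suc k))) = Copy1 (mb_t (Suc (Suc k)))"
| "mb_t _ = Vt"

fun mb_verts :: "nat \<Rightarrow> mb_vertex set" where
  "mb_verts (Suc (Suc (Suc k))) =
     Copy1 ` mb_verts (Suc (Suc k)) \<union> Copy2 ` mb_verts (Suc (Suc k))"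
| "mb_verts _ = {Vs, Va, Vb, Vt}"

text \<open>One orientation of each edge.\<close>

fun mb_edges :: "nat \<Rightarrow> mb_vertex rel" where
  "mb_edges (Suc (Suc (Suc k))) =
     map_prod Copy1 Copy1 ` mb_edges (Suc (Suc k)) \<union>
     map_prod Copy2 Copy2 ` mb_edges (Suc (Suc k)) \<union>
     {(Copy1 (mb_s (Suc (Suc k))), Copy2 (mb_s (Suc (Suc k)))),
      (Copy1 (mb_t (Suc (Suc k))), Copy2 (mb_t (Suc (Suc k))))}"
| "mb_edges _ = {(Vs, Va), (Va, Vb), (Vb, Vt)}"

definition MB :: "nat \<Rightarrow> mb_vertex pair_pre_digraph" where
  "MB k = \<lparr> pverts = mb_verts k, parcs = mb_edges k \<union> (mb_edges k)\<inverse> \<rparr>"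

lemma mb_s_in_verts: "mb_s k \<in> mb_verts k"
  by (induction k rule: mb_s.induct) auto

lemma mb_t_in_verts: "mb_t k \<in> mb_verts k"
  by (induction k rule: mb_t.induct) auto

lemma finite_mb_verts: "finite (mb_verts k)"
  by (induction k rule: mb_verts.induct) auto

lemma mb_edges_subset: "mb_edges k \<subseteq> mb_verts k \<times> mb_verts k"
  by (induction k rule: mb_edges.induct) (auto simp: mb_s_in_verts mb_t_in_verts)

lemma mb_edges_irrefl: "(x, x) \<notin> mb_edges k"
  by (induction k arbitrary: x rule: mb_edges.induct) auto

lemma card_MB:
  assumes "k \<ge> 2"
  shows "card (pverts (MB k)) = 2 ^ k"
proof -
  have "card (mb_verts (Suc (Suc m))) = 2 ^ Suc (Suc m)" for m
  proof (induction m)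
    case (Suc m)
    have "card (mb_verts (Suc (Suc (Suc m)))) =
        card (Copy1 ` mb_verts (Suc (Suc m))) + card (Copy2 ` mb_verts (Suc (Suc m)))"
      unfolding mb_verts.simps(1) by (rule card_Un_disjoint) (auto simp: finite_mb_verts)
    with Suc show ?case by (simp add: card_image inj_on_def)
  qed simp
  from this[of "k - 2"] assms show ?thesis by (simp add: MB_def numeral_2_eq_2 Suc_diff_Suc)
qed

lemma pair_graph_MB: "pair_graph (MB k)"
proof
  show "finite (parcs (MB k))"
    using finite_subset[OF mb_edges_subset] finite_mb_verts by (simp add: MB_def)
qed (use mb_edges_subset mb_edges_irrefl in
      \<open>fastforce simp: MB_def finite_mb_verts symmetric_def sym_Un_converse\<close>)+

lemma connected_MB: "connected (MB k)"
proof -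
  interpret pair_graph "MB k" by (rule pair_graph_MB)
  have sym: "sym ((mb_edges i \<union> (mb_edges i)\<inverse>)\<^sup>*)" for i
    by (simp add: sym_Un_converse sym_rtrancl)
  have emb: "(f x, f y) \<in> (mb_edges j \<union> (mb_edges j)\<inverse>)\<^sup>*"
    if "(x, y) \<in> (mb_edges i \<union> (mb_edges i)\<inverse>)\<^sup>*" "map_prod f f ` mb_edges i \<subseteq> mb_edges j"
    for f x y i j
    using that(1)
  proof induction
    case (step y z)
    then have "(f y, f z) \<in> mb_edges j \<union> (mb_edges j)\<inverse>" using that(2) by force
    with step.IH show ?case by (rule rtrancl_into_rtrancl)
  qed simp
  have base: "(x, Vs) \<in> (E \<union> E\<inverse>)\<^sup>*"
    if "E = {(Vs, Va), (Va, Vb), (Vb, Vt)}" "x = Vs \<or> x = Va \<or> x = Vb \<or> x = Vt" for E x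
  proof -
    have "(Va, Vs) \<in> E \<union> E\<inverse>" "(Vb, Va) \<in> E \<union> E\<inverse>" "(Vt, Vb) \<in> E \<union> E\<inverse>"
      using that(1) by simp_all
    then show ?thesis using that(2) by (meson rtrancl.rtrancl_refl converse_rtrancl_into_rtrancl)
  qed
  have to_s: "(x, mb_s i) \<in> (mb_edges i \<union> (mb_edges i)\<inverse>)\<^sup>*" if "x \<in> mb_verts i" for x i
    using that
  proof (induction i arbitrary: x rule: mb_verts.induct)
    case (1 i)
    let ?E = "mb_edges (Suc (Suc (Suc i))) \<union> (mb_edges (Suc (Suc (Suc i))))\<inverse>"
    let ?s = "mb_s (Suc (Suc i))"
    from "1.prems" obtain y where y: "y \<in> mb_verts (Suc (Suc i))" "x = Copy1 y \<or> x = Copy2 y"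
      by auto
    have "(Copy1 y, Copy1 ?s) \<in> ?E\<^sup>*" "(Copy2 y, Copy2 ?s) \<in> ?E\<^sup>*"
      by (rule emb[OF "1.IH"(1)[OF y(1)]]; auto)+
    moreover have "(Copy1 ?s, Copy2 ?s) \<in> ?E" by simp
    ultimately show ?case using y(2) by (auto simp del: mb_edges.simps intro: rtrancl_into_rtrancl)
  next
    case "2_1"
    then show ?case
      by (simp only: mb_verts.simps mb_edges.simps mb_s.simps insert_iff empty_iff simp_thms base)
  next
    case "2_2"
    then show ?case
      by (simp only: mb_verts.simps mb_edges.simps mb_s.simps insert_iff empty_iff simp_thms base)
  next
    case "2_3"
    then show ?case
      by (simp only: mb_verts.simps mb_edges.simps mb_s.simps insert_iff empty_iff simp_thms base)
  qed
  have "(x, y) \<in> (parcs (MB k))\<^sup>*" if "x \<in> mb_verts k" "y \<in> mb_verts k" for x y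
    using to_s[OF that(1)] symD[OF sym to_s[OF that(2)]] by (simp add: MB_def)
  then have "x \<rightarrow>\<^sup>*\<^bsub>with_proj (MB k)\<^esub> y" if "x \<in> mb_verts k" "y \<in> mb_verts k" for x y
    using that by (simp add: reachable_conv) (simp add: MB_def)
  then show ?thesis
    using mb_s_in_verts[of k] unfolding connected_def strongly_connected_def
    by (auto simp: reachable_mk_symmetric_eq[OF pair_sym_arcs]) (auto simp: MB_def)
qed

end

theory Submission
  imports Defs
begin

text \<open>
  In \<open>MB\<^sub>k\<close> the distances of a vertex to \<open>s\<close> and to \<open>t\<close> always add up to \<open>k + 1\<close>.
  Flooding the graph takes at most \<open>k - 1\<close> rounds once \<open>s\<close> and \<open>t\<close> are informed, and at most
  \<open>k + 1\<close> rounds once one of them is.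

  Upper bound: let the originator have distances \<open>p + q = k\<close> to the terminals of its own half. If
  \<open>min p q < k div 2\<close>, inform the nearer terminal, cross to the other half, and flood both halves.
  Otherwise inform both terminals, starting with the farther one, cross along both
  edges, and flood both halves.

  Lower bound: take \<open>p = k div 2 = m\<close>. No edge to the other half can be used before round \<open>m + 1\<close>,
  and in that round only one of them can, since the first call cannot approach both terminals.
  By doubling, at most \<open>3 \<cdot> 2^i\<close> vertices of the other half are informed after \<open>m + 2 + i\<close> rounds.
\<close>

section \<open>Broadcast schemes\<close>

text \<open>Asking only for a superset of \<open>B\<close> makes the relation monotone in both sets,
  so schemes compose without tracking the exact informed set.\<close>

definition informs :: "'a pair_pre_digraph \<Rightarrow> nat \<Rightarrow> 'a set \<Rightarrow> 'a set \<Rightarrow> bool" where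
  "informs G \<tau> A B \<longleftrightarrow> (\<exists>B'. (broadcast_round G ^^ \<tau>) A B' \<and> B \<subseteq> B')"

lemma broadcast_round_idle: "broadcast_round G A A"
  unfolding broadcast_round_def by (rule exI[of _ "{}"]) auto

lemma broadcast_rounds_idle: "(broadcast_round G ^^ \<tau>) A A"
  by (induction \<tau>) (auto intro: broadcast_round_idle)

text \<open>Calls whose receiver already lies in \<open>A'\<close> are dropped; the remaining ones
  are still legal.\<close>

lemma broadcast_round_mono:
  assumes "broadcast_round G A B" "A \<subseteq> A'"
  shows "broadcast_round G A' (A' \<union> B)"
proof -
  obtain C where C: "C \<subseteq> {(u, w) \<in> parcs G. u \<in> A \<and> w \<notin> A}" "single_valued C"
    "B = A \<union> Range C"
    using assms(1) by (auto simp: broadcast_round_def)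
  let ?C = "{(u, w) \<in> C. w \<notin> A'}"
  have "?C \<subseteq> {(u, w) \<in> parcs G. u \<in> A' \<and> w \<notin> A'}" using C(1) assms(2) by auto
  moreover have "single_valued ?C" using C(2) by (auto simp: single_valued_def)
  moreover have "A' \<union> B = A' \<union> Range ?C" using C(3) assms(2) by auto
  ultimately show ?thesis unfolding broadcast_round_def by blast
qed

lemma broadcast_rounds_mono:
  assumes "(broadcast_round G ^^ \<tau>) A B" "A \<subseteq> A'"
  shows "informs G \<tau> A' B"
  using assms
proof (induction \<tau> arbitrary: B)
  case 0
  then show ?case by (auto simp: informs_def)
next
  case (Suc \<tau>)
  then obtain D where D: "(broadcast_round G ^^ \<tau>) A D" "broadcast_round G D B" by auto
  from Suc.IH[OF D(1) Suc.prems(2)]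
  obtain D' where D': "(broadcast_round G ^^ \<tau>) A' D'" "D \<subseteq> D'"
    by (auto simp: informs_def)
  have "(broadcast_round G ^^ Suc \<tau>) A' (D' \<union> B)"
    using D'(1) broadcast_round_mono[OF D(2) D'(2)] by (rule relpowp_Suc_I)
  then show ?case unfolding informs_def by blast
qed

lemma informs_mono: "informs G \<tau> A B \<Longrightarrow> A \<subseteq> A' \<Longrightarrow> B' \<subseteq> B \<Longrightarrow> informs G \<tau> A' B'"
  using broadcast_rounds_mono unfolding informs_def by (metis subset_trans)

lemma informs_subset: "B \<subseteq> A \<Longrightarrow> informs G \<tau> A B"
  unfolding informs_def using broadcast_rounds_idle by metis

lemma informs_trans:
  assumes "informs G \<tau> A B" "informs G \<tau>' B D"
  shows "informs G (\<tau> + \<tau>') A D"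
proof -
  obtain B' where B': "(broadcast_round G ^^ \<tau>) A B'" "B \<subseteq> B'"
    using assms(1) by (auto simp: informs_def)
  then obtain D' where "(broadcast_round G ^^ \<tau>') B' D'" "D \<subseteq> D'"
    using informs_mono[OF assms(2) B'(2) subset_refl] by (auto simp: informs_def)
  with B'(1) show ?thesis unfolding informs_def relpowp_add by blast
qed

lemma informs_later: "informs G \<tau> A B \<Longrightarrow> \<tau> \<le> \<tau>' \<Longrightarrow> informs G \<tau>' A B"
  using informs_trans[OF _ informs_subset[OF subset_refl], of G \<tau> A B "\<tau>' - \<tau>"] by simp

lemma informs_calls:
  assumes "C \<subseteq> parcs G" "single_valued C" "Domain C \<subseteq> A" "B \<subseteq> A \<union> Range C"
  shows "informs G 1 A B"
proof -
  let ?C = "{(u, w) \<in> C. w \<notin> A}"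
  have "?C \<subseteq> {(u, w) \<in> parcs G. u \<in> A \<and> w \<notin> A}" using assms(1,3) by auto
  moreover have "single_valued ?C" using assms(2) by (auto simp: single_valued_def)
  ultimately have "broadcast_round G A (A \<union> Range ?C)" unfolding broadcast_round_def by blast
  moreover have "B \<subseteq> A \<union> Range ?C" using assms(4) by auto
  ultimately show ?thesis unfolding informs_def by auto
qed

lemma informs_call: "u \<in> A \<Longrightarrow> (u, w) \<in> parcs G \<Longrightarrow> informs G 1 A (insert w A)"
  by (rule informs_calls[of "{(u, w)}"]) (auto simp: single_valued_def)

text \<open>The option \<open>w = u\<close> stands for an idle sender; intersecting the two calls
  with \<open>parcs G\<close> covers all combinations at once.\<close>

lemma informs_two_calls:
  assumes "w = u \<or> (u, w) \<in> parcs G" "w' = u' \<or> (u', w') \<in> parcs G" "u \<noteq> u'"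
  shows "informs G 1 {u, u'} {u, u', w, w'}"
  by (rule informs_calls[of "{(u, w), (u', w')} \<inter> parcs G"])
    (use assms in \<open>auto simp: single_valued_def\<close>)

lemma broadcast_rounds_subset:
  assumes "(broadcast_round G ^^ \<tau>) A B" "A \<subseteq> pverts G" "pair_wf_digraph G"
  shows "B \<subseteq> pverts G"
  using assms(1)
proof (induction \<tau> arbitrary: B)
  case (Suc \<tau>)
  then obtain D where "D \<subseteq> pverts G" "broadcast_round G D B" by auto
  then show ?case
    using pair_wf_digraph.in_arcsD2[OF assms(3)] by (fastforce simp: broadcast_round_def)
qed (use assms(2) in auto)

lemma broadcast_time_from_le:
  assumes "informs G \<tau> {v} (pverts G)" "v \<in> pverts G" "pair_wf_digraph G"
  shows "broadcast_time_from v G \<le> \<tau>"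
proof -
  obtain B where "(broadcast_round G ^^ \<tau>) {v} B" "pverts G \<subseteq> B"
    using assms(1) by (auto simp: informs_def)
  with broadcast_rounds_subset[of \<tau> G "{v}" B] assms
  have "(broadcast_round G ^^ \<tau>) {v} (pverts G)" by (metis empty_subsetI insert_subset subset_antisym)
  then show ?thesis unfolding broadcast_time_from_def by (rule Least_le)
qed

section \<open>Structure of \<open>MB\<^sub>k\<close>\<close>

lemma Suc_ge_2E:
  fixes j :: nat
  assumes "2 \<le> j"
  obtains i where "j = Suc (Suc i)"
  using assms by (metis add_2_eq_Suc le_Suc_ex)

lemma mb_s_Suc: "2 \<le> j \<Longrightarrow> mb_s (Suc j) = Copy2 (mb_s j)"
  by (erule Suc_ge_2E) simp

lemma mb_t_Suc: "2 \<le> j \<Longrightarrow> mb_t (Suc j) = Copy1 (mb_t j)"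
  by (erule Suc_ge_2E) simp

lemma mb_verts_Suc: "2 \<le> j \<Longrightarrow> mb_verts (Suc j) = Copy1 ` mb_verts j \<union> Copy2 ` mb_verts j"
  by (erule Suc_ge_2E) simp

lemma parcs_MB_Suc:
  assumes "2 \<le> j"
  shows "parcs (MB (Suc j)) =
    map_prod Copy1 Copy1 ` parcs (MB j) \<union> map_prod Copy2 Copy2 ` parcs (MB j) \<union>
    {(Copy1 (mb_s j), Copy2 (mb_s j)), (Copy2 (mb_s j), Copy1 (mb_s j)),
     (Copy1 (mb_t j), Copy2 (mb_t j)), (Copy2 (mb_t j), Copy1 (mb_t j))}"
  using assms by (elim Suc_ge_2E) (auto simp: MB_def map_prod_def image_iff split: prod.splits; force)

lemma mb_2: "mb_s 2 = Vs" "mb_t 2 = Vt" "mb_verts 2 = {Vs, Va, Vb, Vt}"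
  by (simp_all add: numeral_2_eq_2)

lemma parcs_MB_2: "parcs (MB 2) = {(Vs, Va), (Va, Vs), (Va, Vb), (Vb, Va), (Vb, Vt), (Vt, Vb)}"
  by (auto simp: MB_def numeral_2_eq_2)

lemma pverts_MB: "pverts (MB k) = mb_verts k"
  by (simp add: MB_def)

section \<open>Distances to the two terminals\<close>

text \<open>No index \<open>k\<close> is needed: the new \<open>s\<close> lies in the second copy,
  so only vertices of the first copy get one step farther from it. For \<open>t\<close> the copies
  swap roles. The Lipschitz and neighbour lemmas below justify the reading as distances.\<close>

primrec dist_s :: "mb_vertex \<Rightarrow> nat" where
  "dist_s Vs = 0"
| "dist_s Va = 1"
| "dist_s Vb = 2"
| "dist_s Vt = 3"
| "dist_s (Copy1 v) = Suc (dist_s v)"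
| "dist_s (Copy2 v) = dist_s v"

primrec dist_t :: "mb_vertex \<Rightarrow> nat" where
  "dist_t Vs = 3"
| "dist_t Va = 2"
| "dist_t Vb = 1"
| "dist_t Vt = 0"
| "dist_t (Copy1 v) = dist_t v"
| "dist_t (Copy2 v) = Suc (dist_t v)"

text \<open>The sum is 3 on the path, and each doubling raises exactly one of the two distances by
  one. Hence approaching one terminal means receding from the other, which drives both
  bounds.\<close>

lemma dist_s_plus_dist_t:
  assumes "2 \<le> k" "v \<in> mb_verts k"
  shows "dist_s v + dist_t v = Suc k"
  using assms
proof (induction k arbitrary: v rule: nat_induct_at_least)
  case base
  then show ?case by (auto simp: mb_2)
next
  case (Suc k)
  then show ?case by (auto simp: mb_verts_Suc)
qed

lemma dist_s_mb_s: "2 \<le> k \<Longrightarrow> dist_s (mb_s k) = 0"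
  by (induction k rule: nat_induct_at_least) (auto simp: mb_2 mb_s_Suc)

lemma dist_t_mb_t: "2 \<le> k \<Longrightarrow> dist_t (mb_t k) = 0"
  by (induction k rule: nat_induct_at_least) (auto simp: mb_2 mb_t_Suc)

lemma dist_s_lipschitz:
  assumes "2 \<le> k" "(u, w) \<in> parcs (MB k)"
  shows "dist_s u \<le> Suc (dist_s w)"
  using assms
proof (induction k arbitrary: u w rule: nat_induct_at_least)
  case base
  then show ?case by (auto simp: parcs_MB_2)
next
  case (Suc k)
  then show ?case by (auto simp: parcs_MB_Suc)
qed

lemma dist_t_lipschitz:
  assumes "2 \<le> k" "(u, w) \<in> parcs (MB k)"
  shows "dist_t u \<le> Suc (dist_t w)"
  using assms
proof (induction k arbitrary: u w rule: nat_induct_at_least)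
  case base
  then show ?case by (auto simp: parcs_MB_2)
next
  case (Suc k)
  then show ?case by (auto simp: parcs_MB_Suc)
qed

lemma parcs_MB_verts: "(u, w) \<in> parcs (MB k) \<Longrightarrow> u \<in> mb_verts k \<and> w \<in> mb_verts k"
  using mb_edges_subset[of k] by (auto simp: MB_def)

lemma neighbour_towards_s:
  assumes "2 \<le> k" "v \<in> mb_verts k" "v \<noteq> mb_s k"
  obtains w where "(v, w) \<in> parcs (MB k)" "dist_s v = Suc (dist_s w)"
proof -
  have "\<exists>w. (v, w) \<in> parcs (MB k) \<and> dist_s v = Suc (dist_s w)"
    using assms
  proof (induction k arbitrary: v rule: nat_induct_at_least)
    case base
    then show ?case by (auto simp: mb_2 parcs_MB_2)
  next
    case (Suc k)
    from Suc.prems(1) Suc.hyps obtain u where u: "u \<in> mb_verts k" "v = Copy1 u \<or> v = Copy2 u"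
      by (auto simp: mb_verts_Suc)
    show ?case
    proof (cases "u = mb_s k")
      case True
      with u(2) Suc.prems(2) Suc.hyps have "v = Copy1 (mb_s k)" by (auto simp: mb_s_Suc)
      then show ?thesis
        using Suc.hyps by (intro exI[of _ "Copy2 (mb_s k)"]) (simp add: parcs_MB_Suc)
    next
      case False
      with Suc.IH u(1) obtain w where "(u, w) \<in> parcs (MB k)" "dist_s u = Suc (dist_s w)" by blast
      with u(2) Suc.hyps show ?thesis by (force simp: parcs_MB_Suc)
    qed
  qed
  with that show thesis by blast
qed

lemma neighbour_towards_t:
  assumes "2 \<le> k" "v \<in> mb_verts k" "v \<noteq> mb_t k"
  obtains w where "(v, w) \<in> parcs (MB k)" "dist_t v = Suc (dist_t w)"
proof -
  have "\<exists>w. (v, w) \<in> parcs (MB k) \<and> dist_t v = Suc (dist_t w)"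
    using assms
  proof (induction k arbitrary: v rule: nat_induct_at_least)
    case base
    then show ?case by (auto simp: mb_2 parcs_MB_2)
  next
    case (Suc k)
    from Suc.prems(1) Suc.hyps obtain u where u: "u \<in> mb_verts k" "v = Copy1 u \<or> v = Copy2 u"
      by (auto simp: mb_verts_Suc)
    show ?case
    proof (cases "u = mb_t k")
      case True
      with u(2) Suc.prems(2) Suc.hyps have "v = Copy2 (mb_t k)" by (auto simp: mb_t_Suc)
      then show ?thesis
        using Suc.hyps by (intro exI[of _ "Copy1 (mb_t k)"]) (simp add: parcs_MB_Suc)
    next
      case False
      with Suc.IH u(1) obtain w where "(u, w) \<in> parcs (MB k)" "dist_t u = Suc (dist_t w)" by blast
      with u(2) Suc.hyps show ?thesis by (force simp: parcs_MB_Suc)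
    qed
  qed
  with that show thesis by blast
qed

lemma ex_dist_s:
  assumes "2 \<le> k" "i \<le> Suc k"
  shows "\<exists>v \<in> mb_verts k. dist_s v = i"
  using assms
proof (induction k arbitrary: i rule: nat_induct_at_least)
  case base
  then consider "i = 0" | "i = 1" | "i = 2" | "i = 3" by linarith
  then show ?case by cases (auto simp: mb_2)
next
  case (Suc k)
  show ?case
  proof (cases i)
    case 0
    then show ?thesis
      using Suc.hyps dist_s_mb_s[of "Suc k"] mb_s_in_verts[of "Suc k"] by auto
  next
    case (Suc i')
    with Suc.IH[of i'] Suc.prems obtain v where "v \<in> mb_verts k" "dist_s v = i'" by auto
    then show ?thesis
      using Suc Suc.hyps by (intro bexI[of _ "Copy1 v"]) (auto simp: mb_verts_Suc)
  qed
qed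

section \<open>Upper bound\<close>

text \<open>The copies share no vertices, so their schemes run in parallel without a vertex calling
  twice.\<close>

lemma informs_halves:
  assumes "2 \<le> j" "informs (MB j) \<tau> A B" "informs (MB j) \<tau> A' B'"
  shows "informs (MB (Suc j)) \<tau> (Copy1 ` A \<union> Copy2 ` A') (Copy1 ` B \<union> Copy2 ` B')"
proof -
  have step: "broadcast_round (MB (Suc j)) (Copy1 ` A \<union> Copy2 ` A') (Copy1 ` B \<union> Copy2 ` B')"
    if r: "broadcast_round (MB j) A B" "broadcast_round (MB j) A' B'" for A B A' B'
  proof -
    obtain C where C: "C \<subseteq> {(u, w) \<in> parcs (MB j). u \<in> A \<and> w \<notin> A}" "single_valued C"
      "B = A \<union> Range C"
      using r(1) by (auto simp: broadcast_round_def)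
    obtain C' where C': "C' \<subseteq> {(u, w) \<in> parcs (MB j). u \<in> A' \<and> w \<notin> A'}" "single_valued C'"
      "B' = A' \<union> Range C'"
      using r(2) by (auto simp: broadcast_round_def)
    let ?C = "map_prod Copy1 Copy1 ` C \<union> map_prod Copy2 Copy2 ` C'"
    have "?C \<subseteq> {(u, w) \<in> parcs (MB (Suc j)).
        u \<in> Copy1 ` A \<union> Copy2 ` A' \<and> w \<notin> Copy1 ` A \<union> Copy2 ` A'}"
      using C(1) C'(1) assms(1) by (force simp: parcs_MB_Suc)
    moreover have "single_valued ?C"
      using C(2) C'(2) by (auto simp: single_valued_def)
    moreover have "Range (map_prod f f ` E) = f ` Range E" for f :: "mb_vertex \<Rightarrow> mb_vertex" and E
      by force
    then have "Copy1 ` B \<union> Copy2 ` B' = Copy1 ` A \<union> Copy2 ` A' \<union> Range ?C"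
      using C(3) C'(3) by (auto simp: Range_Un_eq image_Un)
    ultimately show ?thesis unfolding broadcast_round_def by blast
  qed
  have "(broadcast_round (MB (Suc j)) ^^ \<tau>) (Copy1 ` A \<union> Copy2 ` A') (Copy1 ` B \<union> Copy2 ` B')"
    if "(broadcast_round (MB j) ^^ \<tau>) A B" "(broadcast_round (MB j) ^^ \<tau>) A' B'" for B B'
    using that
  proof (induction \<tau> arbitrary: B B')
    case (Suc \<tau>)
    from Suc.prems obtain D D' where "(broadcast_round (MB j) ^^ \<tau>) A D" "broadcast_round (MB j) D B"
      "(broadcast_round (MB j) ^^ \<tau>) A' D'" "broadcast_round (MB j) D' B'" by auto
    with Suc.IH step show ?case by (meson relpowp_Suc_I)
  qed simp
  with assms(2,3) show ?thesis
    unfolding informs_def by (meson Un_mono image_mono)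
qed

text \<open>One call across the \<open>s\<close> edge puts each half in the same situation one level
  down; the path takes 3 rounds.\<close>

lemma informs_MB_from_s: "2 \<le> k \<Longrightarrow> informs (MB k) (Suc k) {mb_s k} (mb_verts k)"
proof (induction k rule: nat_induct_at_least)
  case base
  have 1: "informs (MB 2) 1 {Vs} {Va, Vs}"
    by (rule informs_call) (auto simp: parcs_MB_2)
  have 2: "informs (MB 2) 1 {Va, Vs} {Vb, Va, Vs}"
    by (rule informs_call) (auto simp: parcs_MB_2)
  have 3: "informs (MB 2) 1 {Vb, Va, Vs} {Vt, Vb, Va, Vs}"
    by (rule informs_call) (auto simp: parcs_MB_2)
  show ?case
    using informs_trans[OF informs_trans[OF 1 2] 3]
    by (simp add: mb_2 insert_commute numeral_3_eq_3)
next
  case (Suc k)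
  have "informs (MB (Suc k)) 1 {Copy2 (mb_s k)} {Copy1 (mb_s k), Copy2 (mb_s k)}"
    by (rule informs_call) (use Suc.hyps in \<open>auto simp: parcs_MB_Suc\<close>)
  from informs_trans[OF informs_mono[OF this] informs_halves[OF Suc.hyps Suc.IH Suc.IH]] Suc.hyps
  show ?case by (simp add: mb_s_Suc mb_verts_Suc)
qed

lemma informs_MB_from_t: "2 \<le> k \<Longrightarrow> informs (MB k) (Suc k) {mb_t k} (mb_verts k)"
proof (induction k rule: nat_induct_at_least)
  case base
  have 1: "informs (MB 2) 1 {Vt} {Vb, Vt}"
    by (rule informs_call) (auto simp: parcs_MB_2)
  have 2: "informs (MB 2) 1 {Vb, Vt} {Va, Vb, Vt}"
    by (rule informs_call) (auto simp: parcs_MB_2)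
  have 3: "informs (MB 2) 1 {Va, Vb, Vt} {Vs, Va, Vb, Vt}"
    by (rule informs_call) (auto simp: parcs_MB_2)
  show ?case
    using informs_trans[OF informs_trans[OF 1 2] 3]
    by (simp add: mb_2 insert_commute numeral_3_eq_3)
next
  case (Suc k)
  have "informs (MB (Suc k)) 1 {Copy1 (mb_t k)} {Copy2 (mb_t k), Copy1 (mb_t k)}"
    by (rule informs_call) (use Suc.hyps in \<open>auto simp: parcs_MB_Suc\<close>)
  from informs_trans[OF informs_mono[OF this] informs_halves[OF Suc.hyps Suc.IH Suc.IH]] Suc.hyps
  show ?case by (simp add: mb_t_Suc mb_verts_Suc)
qed

text \<open>The terminals lie in different copies, so a single round crosses both edges and leaves
  each copy with both of its own terminals informed.\<close>

lemma informs_MB_from_both: "2 \<le> k \<Longrightarrow> informs (MB k) (k - 1) {mb_s k, mb_t k} (mb_verts k)"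
proof (induction k rule: nat_induct_at_least)
  case base
  have "informs (MB 2) 1 {Vs, Vt} {Vs, Vt, Va, Vb}"
    by (rule informs_two_calls) (auto simp: parcs_MB_2)
  then show ?case by (simp add: mb_2 insert_commute)
next
  case (Suc k)
  have "informs (MB (Suc k)) 1 {Copy2 (mb_s k), Copy1 (mb_t k)}
      {Copy2 (mb_s k), Copy1 (mb_t k), Copy1 (mb_s k), Copy2 (mb_t k)}"
    by (rule informs_two_calls) (use Suc.hyps in \<open>auto simp add: parcs_MB_Suc\<close>)
  from informs_trans[OF informs_mono[OF this] informs_halves[OF Suc.hyps Suc.IH Suc.IH]] Suc.hyps
  show ?case by (simp add: mb_s_Suc mb_t_Suc mb_verts_Suc)
qed

section \<open>Routing the message to the terminals\<close>

lemma informs_s: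
  assumes "2 \<le> k" "v \<in> mb_verts k"
  shows "informs (MB k) (dist_s v) {v} {mb_s k}"
  using assms(2)
proof (induction "dist_s v" arbitrary: v)
  case 0
  then have "v = mb_s k" using neighbour_towards_s[OF assms(1)] by (metis nat.distinct(1))
  then show ?case by (simp add: informs_subset)
next
  case (Suc n)
  then have "v \<noteq> mb_s k" using dist_s_mb_s[OF assms(1)] by auto
  then obtain w where w: "(v, w) \<in> parcs (MB k)" "dist_s v = Suc (dist_s w)"
    using neighbour_towards_s assms(1) Suc.prems by blast
  then have "informs (MB k) (dist_s w) {w} {mb_s k}" using Suc parcs_MB_verts by auto
  from informs_trans[OF informs_mono[OF informs_call[OF _ w(1)]] this, of "{v}" "{v}"] w(2) show ?case by simp
qed

lemma informs_t:
  assumes "2 \<le> k" "v \<in> mb_verts k"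
  shows "informs (MB k) (dist_t v) {v} {mb_t k}"
  using assms(2)
proof (induction "dist_t v" arbitrary: v)
  case 0
  then have "v = mb_t k" using neighbour_towards_t[OF assms(1)] by (metis nat.distinct(1))
  then show ?case by (simp add: informs_subset)
next
  case (Suc n)
  then have "v \<noteq> mb_t k" using dist_t_mb_t[OF assms(1)] by auto
  then obtain w where w: "(v, w) \<in> parcs (MB k)" "dist_t v = Suc (dist_t w)"
    using neighbour_towards_t assms(1) Suc.prems by blast
  then have "informs (MB k) (dist_t w) {w} {mb_t k}" using Suc parcs_MB_verts by auto
  from informs_trans[OF informs_mono[OF informs_call[OF _ w(1)]] this, of "{v}" "{v}"] w(2) show ?case by simp
qed

text \<open>The message travels from \<open>u\<close> to \<open>s\<close> and from \<open>v\<close> to \<open>t\<close> simultaneously; the invariant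
  \<open>dist_s u < dist_s v\<close> ensures that the two senders are always distinct.\<close>

lemma informs_s_t:
  assumes "2 \<le> k" "u \<in> mb_verts k" "v \<in> mb_verts k" "dist_s u < dist_s v"
    "dist_s u \<le> \<tau>" "dist_t v \<le> \<tau>"
  shows "informs (MB k) \<tau> {u, v} {mb_s k, mb_t k}"
  using assms(2-)
proof (induction \<tau> arbitrary: u v)
  case 0
  then have "u = mb_s k" "v = mb_t k"
    using neighbour_towards_s[OF assms(1)] neighbour_towards_t[OF assms(1)]
    by (metis le_zero_eq nat.distinct(1))+
  then show ?case by (simp add: informs_subset)
next
  case (Suc \<tau>)
  \<comment> \<open>At the terminal itself the truncated subtraction gives 0 and the sender
    idles.\<close>
  obtain u' where u': "u' = u \<or> (u, u') \<in> parcs (MB k)" "dist_s u' = dist_s u - 1"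
    using neighbour_towards_s[OF assms(1) Suc.prems(1)] dist_s_mb_s[OF assms(1)]
    by (metis diff_0_eq_0 diff_Suc_1)
  obtain v' where v': "v' = v \<or> (v, v') \<in> parcs (MB k)" "dist_t v' = dist_t v - 1"
    using neighbour_towards_t[OF assms(1) Suc.prems(2)] dist_t_mb_t[OF assms(1)]
    by (metis diff_0_eq_0 diff_Suc_1)
  have verts: "u' \<in> mb_verts k" "v' \<in> mb_verts k"
    using u'(1) v'(1) Suc.prems(1,2) parcs_MB_verts by auto
  \<comment> \<open>The distance sum is constant, so moving towards \<open>t\<close> never decreases
    \<open>dist_s\<close>; this preserves the invariant.\<close>
  have "dist_s v \<le> dist_s v'"
    using v'(2) dist_s_plus_dist_t[OF assms(1)] Suc.prems(2) verts(2)
    by (metis add_le_cancel_right diff_le_self nat_add_left_cancel_le order_refl)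
  then have "informs (MB k) \<tau> {u', v'} {mb_s k, mb_t k}"
    using Suc.prems u'(2) v'(2) by (intro Suc.IH verts) auto
  moreover have "informs (MB k) 1 {u, v} {u', v'}"
    by (rule informs_mono[OF informs_two_calls[OF u'(1) v'(1)]]) (use Suc.prems(3) in auto)
  ultimately show ?case using informs_trans by fastforce
qed


text \<open>After the first call, the receiver's message heads for \<open>s\<close> and the
  originator starts towards \<open>t\<close>, one round late. Hence the bound on
  \<open>dist_t v\<close> is smaller by one.\<close>

lemma informs_both_s_first:
  assumes "2 \<le> k" "v \<in> mb_verts k" "0 < dist_s v" "dist_s v \<le> Suc \<tau>" "dist_t v \<le> \<tau>"
  shows "informs (MB k) (Suc \<tau>) {v} {mb_s k, mb_t k}"
proof -
  have "v \<noteq> mb_s k" using assms(3) dist_s_mb_s[OF assms(1)] by auto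
  then obtain w where w: "(v, w) \<in> parcs (MB k)" "dist_s v = Suc (dist_s w)"
    using neighbour_towards_s[OF assms(1,2)] by blast
  have "informs (MB k) \<tau> {w, v} {mb_s k, mb_t k}"
    using assms w parcs_MB_verts by (intro informs_s_t) auto
  with informs_call[OF singletonI w(1)] have "informs (MB k) (1 + \<tau>) {v} {mb_s k, mb_t k}"
    by (rule informs_trans)
  then show ?thesis by simp
qed

lemma informs_both_t_first:
  assumes "2 \<le> k" "v \<in> mb_verts k" "0 < dist_t v" "dist_s v \<le> \<tau>" "dist_t v \<le> Suc \<tau>"
  shows "informs (MB k) (Suc \<tau>) {v} {mb_s k, mb_t k}"
proof -
  have "v \<noteq> mb_t k" using assms(3) dist_t_mb_t[OF assms(1)] by auto
  then obtain w where w: "(v, w) \<in> parcs (MB k)" "dist_t v = Suc (dist_t w)"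
    using neighbour_towards_t[OF assms(1,2)] by blast
  then have "w \<in> mb_verts k" using parcs_MB_verts by blast
  then have "dist_s v < dist_s w"
    using w(2) dist_s_plus_dist_t[OF assms(1,2)] dist_s_plus_dist_t[OF assms(1), of w] by simp
  then have "informs (MB k) \<tau> {v, w} {mb_s k, mb_t k}"
    using assms w(2) \<open>w \<in> mb_verts k\<close> by (intro informs_s_t) auto
  then have "informs (MB k) (1 + \<tau>) {v} {mb_s k, mb_t k}"
    using informs_trans[OF informs_call[OF singletonI w(1)]] by (simp add: insert_commute)
  then show ?thesis by simp
qed

text \<open>\<open>T\<close> is the set of terminals used for crossing. They are distinct senders,
  so a single round serves all of them, between routing and flooding.\<close>

lemma informs_across:
  assumes "2 \<le> j" "c = Copy1 \<or> c = Copy2" "T \<subseteq> {mb_s j, mb_t j}"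
    "informs (MB j) \<tau> {x} T" "informs (MB j) \<tau>' T (mb_verts j)"
  shows "informs (MB (Suc j)) (\<tau> + Suc \<tau>') {c x} (mb_verts (Suc j))"
proof -
  obtain d where d: "c = Copy1 \<and> d = Copy2 \<or> c = Copy2 \<and> d = Copy1"
    using assms(2) by blast
  have "informs (MB j) \<tau> {} {}" by (simp add: informs_subset)
  with assms have "informs (MB (Suc j)) \<tau> {c x} (c ` T)"
    using informs_halves[OF assms(1,4), of "{}" "{}"] informs_halves[OF assms(1) _ assms(4), of "{}" "{}"]
    by auto
  moreover have "informs (MB (Suc j)) 1 (c ` T) (Copy1 ` T \<union> Copy2 ` T)"
    by (rule informs_calls[of "(\<lambda>v. (c v, d v)) ` T"])
      (use assms(1,3) d in \<open>auto simp: parcs_MB_Suc single_valued_def Range_iff\<close>)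
  moreover have "informs (MB (Suc j)) \<tau>' (Copy1 ` T \<union> Copy2 ` T) (mb_verts (Suc j))"
    using informs_halves[OF assms(1,5,5)] assms(1) by (simp add: mb_verts_Suc)
  ultimately have "informs (MB (Suc j)) (\<tau> + 1 + \<tau>') {c x} (mb_verts (Suc j))"
    using informs_trans by blast
  then show ?thesis by simp
qed

lemma informs_MB:
  assumes "2 \<le> k" "v \<in> mb_verts k"
  shows "informs (MB k) (3 * k div 2) {v} (mb_verts k)"
proof (cases "k = 2")
  case True
  \<comment> \<open>For \<open>k = 2\<close> there are no halves: an inner vertex calls the other
    one, then both call outwards. The ends flood the path.\<close>
  have inner: "informs (MB 2) 3 {x} (mb_verts 2)" if "x = Va \<or> x = Vb" for x
  proof -
    have "informs (MB 2) 1 {x} {Va, Vb}"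
      by (rule informs_calls[of "{(x, if x = Va then Vb else Va)}"])
        (use that in \<open>auto simp: parcs_MB_2 single_valued_def\<close>)
    moreover have "informs (MB 2) 1 {Va, Vb} {Va, Vb, Vs, Vt}"
      by (rule informs_two_calls) (auto simp: parcs_MB_2)
    ultimately have "informs (MB 2) (1 + 1) {x} {Va, Vb, Vs, Vt}" by (rule informs_trans)
    then have "informs (MB 2) 3 {x} {Va, Vb, Vs, Vt}" by (rule informs_later) simp
    then show ?thesis by (simp add: mb_2 insert_commute)
  qed
  show ?thesis
    using assms(2) inner informs_MB_from_s[of 2] informs_MB_from_t[of 2] True
    by (auto simp: mb_2 numeral_3_eq_3)
next
  case False
  define j where "j = k - 1"
  have k: "k = Suc j" "2 \<le> j" using assms(1) False by (auto simp: j_def)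
  obtain c x where v: "v = c x" "c = Copy1 \<or> c = Copy2" "x \<in> mb_verts j"
    using assms(2) k by (auto simp: mb_verts_Suc)
  note across = informs_across[OF k(2) v(2), of _ _ x, folded k(1) v(1)]
  have sum: "dist_s x + dist_t x = k" using dist_s_plus_dist_t k v(3) by simp
  consider "dist_s x < k div 2" | "dist_t x < k div 2"
    | "k div 2 \<le> dist_s x" "k div 2 \<le> dist_t x" by linarith
  then show ?thesis
  proof cases
    case 1
    \<comment> \<open>Here \<open>Suc (Suc j) = k + 1\<close>, and \<open>dist_s x\<close> is at
      most \<open>k div 2 - 1\<close>, so the total is at most \<open>k + k div 2\<close>.\<close>
    have "informs (MB k) (dist_s x + Suc (Suc j)) {v} (mb_verts k)"
      by (rule across[OF _ informs_s[OF k(2) v(3)] informs_MB_from_s[OF k(2)]]) simp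
    then show ?thesis by (rule informs_later) (use 1 k(1) in auto)
  next
    case 2
    have "informs (MB k) (dist_t x + Suc (Suc j)) {v} (mb_verts k)"
      by (rule across[OF _ informs_t[OF k(2) v(3)] informs_MB_from_t[OF k(2)]]) simp
    then show ?thesis by (rule informs_later) (use 2 k(1) in auto)
  next
    case 3
    have pos: "0 < k div 2" using assms(1) by simp
    \<comment> \<open>With \<open>m = k div 2\<close>, the distances are \<open>m\<close> and
      \<open>k - m\<close>, the latter at most \<open>m + 1\<close>. Serving the farther terminal
      first costs \<open>m + 1\<close> rounds; crossing and flooding add \<open>1 + (j - 1)\<close>,
      for a total of \<open>k + m\<close>.\<close>
    have "informs (MB j) (Suc (k div 2)) {x} {mb_s j, mb_t j}"
    proof (cases "dist_s x = k div 2")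
      case True
      then show ?thesis
        using sum 3 pos by (intro informs_both_t_first[OF k(2) v(3)]) auto
    next
      case False
      then show ?thesis
        using sum 3 pos by (intro informs_both_s_first[OF k(2) v(3)]) auto
    qed
    from across[OF subset_refl this informs_MB_from_both[OF k(2)]]
    show ?thesis by (rule informs_later) (use k in auto)
  qed
qed

section \<open>Lower bound\<close>

text \<open>Each round lowers the minimum of \<open>f\<close> over the informed vertices by at most
  one.\<close>

lemma broadcast_rounds_potential:
  fixes f :: "'a \<Rightarrow> nat"
  assumes "(broadcast_round G ^^ \<tau>) A B" "\<And>u w. (u, w) \<in> parcs G \<Longrightarrow> f u \<le> Suc (f w)"
    "\<And>v. v \<in> A \<Longrightarrow> c \<le> f v" "v \<in> B"
  shows "c \<le> f v + \<tau>"
  using assms(1,4)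
proof (induction \<tau> arbitrary: B v)
  case 0
  then show ?case using assms(3) by simp
next
  case (Suc \<tau>)
  then obtain D where D: "(broadcast_round G ^^ \<tau>) A D" "broadcast_round G D B" by auto
  with Suc.prems(2) consider "v \<in> D" | u where "u \<in> D" "(u, v) \<in> parcs G"
    by (auto simp: broadcast_round_def)
  then show ?case
  proof cases
    case 1
    with Suc.IH[OF D(1)] show ?thesis by fastforce
  next
    case 2
    with Suc.IH[OF D(1) 2(1)] assms(2)[OF 2(2)] show ?thesis by simp
  qed
qed

text \<open>Calls from outside \<open>W\<close> can only enter at \<open>T\<close>. Counting
  \<open>T\<close> as informed on both sides makes them free, and every other new vertex of
  \<open>W\<close> is charged to its own sender in \<open>A \<inter> W\<close>.\<close>

lemma broadcast_round_card:
  assumes "broadcast_round G A B" "finite A" "finite W" "finite T"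
    and gates: "\<And>u w. (u, w) \<in> parcs G \<Longrightarrow> w \<in> W \<Longrightarrow> u \<in> W \<or> w \<in> T"
  shows "card (B \<inter> W \<union> T) \<le> card (A \<inter> W \<union> T) + card (A \<inter> W)"
proof -
  obtain C where C: "C \<subseteq> {(u, w) \<in> parcs G. u \<in> A \<and> w \<notin> A}" "single_valued C"
    "B = A \<union> Range C"
    using assms(1) by (auto simp: broadcast_round_def)
  \<comment> \<open>The unique receiver of each sender in \<open>W\<close>; an idle sender
    contributes an arbitrary value, which only enlarges the set.\<close>
  let ?R = "(\<lambda>u. SOME w. (u, w) \<in> C) ` (A \<inter> W)"
  have "(SOME w. (u, w) \<in> C) = w" if "(u, w) \<in> C" for u w
    using that C(2) by (metis single_valuedD someI_ex)
  then have "w \<in> ?R" if "(u, w) \<in> C" "u \<in> W" for u w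
    using that C(1) by (force simp: image_iff)
  then have "B \<inter> W \<union> T \<subseteq> (A \<inter> W \<union> T) \<union> ?R"
    using C gates by fastforce
  then have "card (B \<inter> W \<union> T) \<le> card ((A \<inter> W \<union> T) \<union> ?R)"
    using assms(2-4) by (intro card_mono) auto
  also have "\<dots> \<le> card (A \<inter> W \<union> T) + card ?R" by (rule card_Un_le)
  also have "card ?R \<le> card (A \<inter> W)" using assms(2) by (intro card_image_le) auto
  finally show ?thesis by simp
qed

text \<open>The distances in \<open>MB\<^sub>k\<close> to the second copy and to the terminal \<open>t\<close> of that copy; the distance to
  its terminal \<open>s\<close> is \<open>dist_s\<close> itself. The values at base vertices, which occur only for \<open>k = 2\<close>,
  are irrelevant.\<close>

primrec to_copy2 :: "mb_vertex \<Rightarrow> nat" where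
  "to_copy2 (Copy1 v) = Suc (min (dist_s v) (dist_t v))"
| "to_copy2 (Copy2 v) = 0"
| "to_copy2 Vs = 0" | "to_copy2 Va = 0" | "to_copy2 Vb = 0" | "to_copy2 Vt = 0"

primrec to_copy2_t :: "mb_vertex \<Rightarrow> nat" where
  "to_copy2_t (Copy1 v) = Suc (dist_t v)"
| "to_copy2_t (Copy2 v) = dist_t v"
| "to_copy2_t Vs = 0" | "to_copy2_t Va = 0" | "to_copy2_t Vb = 0" | "to_copy2_t Vt = 0"

lemma to_copy2_lipschitz:
  assumes "2 \<le> j" "(u, w) \<in> parcs (MB (Suc j))"
  shows "to_copy2 u \<le> Suc (to_copy2 w)"
proof -
  have "min (dist_s u) (dist_t u) \<le> Suc (min (dist_s w) (dist_t w))"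
    if "(u, w) \<in> parcs (MB j)" for u w
    using dist_s_lipschitz[OF assms(1) that] dist_t_lipschitz[OF assms(1) that] by simp
  with assms show ?thesis
    by (fastforce simp: parcs_MB_Suc dist_s_mb_s dist_t_mb_t)
qed

lemma to_copy2_t_lipschitz:
  "2 \<le> j \<Longrightarrow> (u, w) \<in> parcs (MB (Suc j)) \<Longrightarrow> to_copy2_t u \<le> Suc (to_copy2_t w)"
  using dist_t_lipschitz by (auto simp: parcs_MB_Suc)

lemma broadcast_rounds_MB_lower:
  assumes j: "2 \<le> j" and x: "x \<in> mb_verts j" "m \<le> dist_s x" "m \<le> dist_t x" and m: "0 < m"
    and T: "(broadcast_round (MB (Suc j)) ^^ T) {Copy1 x} (mb_verts (Suc j))"
  shows "m + j < T"
proof (rule ccontr)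
  let ?round = "broadcast_round (MB (Suc j))"
  let ?W = "Copy2 ` mb_verts j"
  let ?gates = "{Copy2 (mb_s j), Copy2 (mb_t j)}"
  interpret pair_graph "MB (Suc j)" by (rule pair_graph_MB)
  have finite_rounds: "finite A" if "(?round ^^ \<tau>) {Copy1 x} A" for \<tau> A
    using broadcast_rounds_subset[OF that] x(1) j finite_mb_verts[of "Suc j"]
      pair_wf_digraph_axioms by (auto simp: pverts_MB mb_verts_Suc intro: finite_subset)
  have gates: "u \<in> ?W \<or> w \<in> ?gates" if "(u, w) \<in> parcs (MB (Suc j))" "w \<in> ?W" for u w
    using that j by (auto simp: parcs_MB_Suc dest: parcs_MB_verts)
  have growth: "card (B \<inter> ?W \<union> ?gates) \<le> card (A \<inter> ?W \<union> ?gates) + card (A \<inter> ?W)"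
    if "?round A B" "finite A" for A B
    by (rule broadcast_round_card[OF that]) (use gates finite_mb_verts in auto)
  have unreached: "A \<inter> ?W = {}" if "(?round ^^ \<tau>) {Copy1 x} A" "\<tau> \<le> m" for \<tau> A
  proof -
    \<comment> \<open>The potential is at least \<open>m + 1\<close> at the originator and 0 on the
      second copy.\<close>
    have "Suc m \<le> to_copy2 v + \<tau>" if "v \<in> A" for v
      by (rule broadcast_rounds_potential[OF \<open>(?round ^^ \<tau>) {Copy1 x} A\<close> to_copy2_lipschitz[OF j]])
        (use x that in auto)
    with that(2) show ?thesis by fastforce
  qed
  have arrival: "card (A \<inter> ?W) \<le> 1 \<and> A \<inter> ?W \<subseteq> ?gates"
    if A: "(?round ^^ Suc m) {Copy1 x} A" for A
  proof -
    obtain D where D: "(?round ^^ m) {Copy1 x} D" "?round D A" using A by auto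
    \<comment> \<open>Before round \<open>m + 1\<close> no sender lies in the second copy, so its
      first informed vertices are gates.\<close>
    have sub: "A \<inter> ?W \<subseteq> ?gates"
      using D(2) gates unreached[OF D(1)] by (fastforce simp: broadcast_round_def)
    obtain F where F: "?round {Copy1 x} F" "(?round ^^ m) F A"
      using A by (meson relpowp_Suc_D2)
    obtain y where y: "y \<in> F" "F \<subseteq> {Copy1 x, y}" "y = Copy1 x \<or> (Copy1 x, y) \<in> parcs (MB (Suc j))"
    proof -
      obtain C where C: "C \<subseteq> {(u, w) \<in> parcs (MB (Suc j)). u \<in> {Copy1 x} \<and> w \<notin> {Copy1 x}}"
        "single_valued C" "F = {Copy1 x} \<union> Range C"
        using F(1) by (auto simp: broadcast_round_def)
      show thesis
      proof (cases "C = {}")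
        case True
        with C(3) that[of "Copy1 x"] show ?thesis by auto
      next
        case False
        then obtain w where "(Copy1 x, w) \<in> C" using C(1) by fastforce
        with C have "Range C = {w}" "(Copy1 x, w) \<in> parcs (MB (Suc j))"
          by (auto dest: single_valuedD)
        with C(3) that[of w] show ?thesis by auto
      qed
    qed
    \<comment> \<open>The first call stays in the first copy because \<open>m > 0\<close>. Since the
      distance sum is constant, it fails to approach one terminal, so \<open>F\<close> is still
      \<open>m + 1\<close> steps from that terminal's gate, too far for the remaining
      \<open>m\<close> rounds.\<close>
    have "(\<forall>v \<in> F. Suc m \<le> dist_s v) \<or> (\<forall>v \<in> F. Suc m \<le> to_copy2_t v)"
    proof -
      have "y \<notin> ?W" using unreached[of 1 F] F(1) m y(1) by auto
      moreover have "y \<in> mb_verts (Suc j)"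
        using y(3)
      proof
        assume "y = Copy1 x"
        then show ?thesis using x(1) j by (simp add: mb_verts_Suc)
      qed (use parcs_MB_verts in blast)
      ultimately obtain y' where y': "y = Copy1 y'" "y' \<in> mb_verts j"
        using j by (auto simp: mb_verts_Suc)
      have "dist_s y' + dist_t y' = dist_s x + dist_t x"
        using dist_s_plus_dist_t[OF j] x(1) y'(2) by simp
      then have "dist_s x \<le> dist_s y' \<or> dist_t x \<le> dist_t y'" by linarith
      then show ?thesis using x(2,3) y(2) y'(1) by fastforce
    qed
    then have "Copy2 (mb_s j) \<notin> A \<or> Copy2 (mb_t j) \<notin> A"
    proof
      assume "\<forall>v \<in> F. Suc m \<le> dist_s v"
      then have "Suc m \<le> dist_s v + m" if "v \<in> A" for v
        by (intro broadcast_rounds_potential[OF F(2) dist_s_lipschitz])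
          (use j that in auto)
      then show ?thesis using dist_s_mb_s[OF j] by fastforce
    next
      assume "\<forall>v \<in> F. Suc m \<le> to_copy2_t v"
      then have "Suc m \<le> to_copy2_t v + m" if "v \<in> A" for v
        by (intro broadcast_rounds_potential[OF F(2) to_copy2_t_lipschitz[OF j]])
          (use that in auto)
      then show ?thesis using dist_t_mb_t[OF j] by fastforce
    qed
    with sub have "A \<inter> ?W \<subseteq> {Copy2 (mb_s j)} \<or> A \<inter> ?W \<subseteq> {Copy2 (mb_t j)}" by blast
    then have "card (A \<inter> ?W) \<le> 1" by (auto dest!: card_mono[rotated])
    with sub show ?thesis by blast
  qed
  \<comment> \<open>The gates count as informed throughout. After round \<open>m + 1\<close> at most
    one vertex of the copy really is, so round \<open>m + 2\<close> yields at most 2 + 1 = 3;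
    afterwards the count at most doubles.\<close>
  have bound: "card (A \<inter> ?W \<union> ?gates) \<le> 3 * 2 ^ i"
    if "(?round ^^ (Suc (Suc m) + i)) {Copy1 x} A" for A i
    using that
  proof (induction i arbitrary: A)
    case 0
    then obtain D where D: "(?round ^^ Suc m) {Copy1 x} D" "?round D A" by auto
    have "D \<inter> ?W \<union> ?gates = ?gates" using arrival[OF D(1)] by blast
    then have "card (D \<inter> ?W \<union> ?gates) \<le> 2" by (simp add: card_insert_if)
    with growth[OF D(2) finite_rounds[OF D(1)]] arrival[OF D(1)] show ?case by simp
  next
    case (Suc i)
    then obtain D where D: "(?round ^^ (Suc (Suc m) + i)) {Copy1 x} D" "?round D A" by auto
    have "card (D \<inter> ?W) \<le> card (D \<inter> ?W \<union> ?gates)"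
      using finite_rounds[OF D(1)] by (intro card_mono) auto
    with growth[OF D(2) finite_rounds[OF D(1)]] Suc.IH[OF D(1)] show ?case by simp
  qed
  assume "\<not> m + j < T"
  \<comment> \<open>Idle rounds pad \<open>T\<close> to exactly \<open>m + j\<close>, where the
    bound allows only \<open>3 * 2 ^ (j - 2)\<close> of the \<open>4 * 2 ^ (j - 2)\<close>
    vertices.\<close>
  then have eq: "Suc (Suc m) + (j - 2) = T + (m + j - T)" using j by simp
  have "(?round ^^ (Suc (Suc m) + (j - 2))) {Copy1 x} (mb_verts (Suc j))"
    unfolding eq relpowp_add using T broadcast_rounds_idle by (rule relcomppI)
  then have "card (mb_verts (Suc j) \<inter> ?W \<union> ?gates) \<le> 3 * 2 ^ (j - 2)" by (rule bound)
  moreover have "mb_verts (Suc j) \<inter> ?W \<union> ?gates = ?W"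
    using j mb_s_in_verts mb_t_in_verts by (auto simp: mb_verts_Suc)
  moreover have "card ?W = 2 ^ j"
    using card_MB[OF j] by (simp add: card_image inj_on_def pverts_MB)
  moreover have "(2::nat) ^ j = 4 * 2 ^ (j - 2)"
    using j by (metis le_add_diff_inverse power_add power2_eq_square numeral_Bit0 mult_2 mult_numeral_1_right)
  ultimately show False by simp
qed

lemma ex_broadcast_time_from_MB_ge:
  assumes "2 \<le> k"
  shows "\<exists>v \<in> mb_verts k. 3 * k div 2 \<le> broadcast_time_from v (MB k)"
proof -
  have rounds: "(broadcast_round (MB k) ^^ broadcast_time_from v (MB k)) {v} (mb_verts k)"
    if "v \<in> mb_verts k" for v
    using LeastI_ex[OF broadcast_possible[OF pair_graph_MB connected_MB]] that
    unfolding broadcast_time_from_def by (simp add: pverts_MB)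
  show ?thesis
  proof (cases "k = 2")
    case True
    \<comment> \<open>On the path the distance between the ends already forces 3 rounds.\<close>
    have "3 \<le> dist_t Vt + broadcast_time_from Vs (MB k)"
      by (rule broadcast_rounds_potential[OF rounds dist_t_lipschitz])
        (use True in \<open>auto simp: mb_2\<close>)
    then show ?thesis using True by (intro bexI[of _ Vs]) (auto simp: mb_2)
  next
    case False
    define j where "j = k - 1"
    have k: "k = Suc j" "2 \<le> j" using assms False by (auto simp: j_def)
    \<comment> \<open>A central vertex: its other distance is \<open>k - k div 2\<close>, so both
      are at least \<open>k div 2\<close>.\<close>
    obtain x where x: "x \<in> mb_verts j" "dist_s x = k div 2"
      using ex_dist_s[OF k(2), of "k div 2"] k(1) by auto
    then have "k div 2 \<le> dist_t x" using dist_s_plus_dist_t[OF k(2)] k(1) by fastforce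
    moreover have "Copy1 x \<in> mb_verts k" using x(1) k by (simp add: mb_verts_Suc)
    ultimately have "k div 2 + j < broadcast_time_from (Copy1 x) (MB k)"
      using broadcast_rounds_MB_lower[OF k(2) x(1)] x(2) rounds k assms by simp
    with \<open>Copy1 x \<in> mb_verts k\<close> show ?thesis using k(1) by (intro bexI[of _ "Copy1 x"]) auto
  qed
qed

lemma broadcast_time_MB:
  assumes "2 \<le> k"
  shows "broadcast_time (MB k) = 3 * k div 2"
proof -
  interpret pair_graph "MB k" by (rule pair_graph_MB)
  have le: "broadcast_time_from v (MB k) \<le> 3 * k div 2" if "v \<in> mb_verts k" for v
    using broadcast_time_from_le informs_MB[OF assms that] that pair_wf_digraph_axioms
    by (metis pverts_MB)
  moreover obtain v where "v \<in> mb_verts k" "3 * k div 2 \<le> broadcast_time_from v (MB k)"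
    using ex_broadcast_time_from_MB_ge[OF assms] by blast
  ultimately show ?thesis
    unfolding broadcast_time_def pverts_MB
    by (intro Max_eqI) (auto simp: finite_mb_verts image_iff intro: le_antisym)
qed

theorem theorem2:
  fixes k n :: nat
  assumes "k \<ge> 2" and "n = 2 ^ k"
  shows "int (broadcast_time (MB k)) = \<lfloor>3 * log 2 (real n) / 2\<rfloor>"
proof -
  have "log 2 (real n) = real k" using assms(2) by (simp add: log_nat_power)
  \<comment> \<open>As a quotient of casts of naturals, its floor is natural division.\<close>
  then have "3 * log 2 (real n) / 2 = real (3 * k) / real 2" by simp
  then show ?thesis
    unfolding broadcast_time_MB[OF assms(1)] by (simp only: floor_divide_of_nat_eq)
qed

end
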